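(* There is a universal constant $C>0$ such that for every $p\in[-\infty,\infty]$, $p\ne 0$, and every $r\in(0,1)\cap\mathbb{Q}$ the following hold. If $p>0$, then \[ \left| h_p(r)-\mathds{1}_{\{Tr\ne 0\}}\left(\frac{1}{8\,Tr}+\frac{1}{2p}\log\frac{1}{Tr}\right)\right|\le C\max\left\{1,\frac1p\log\frac1p\right\}. \] If $p<0$, then \[ \left| h_p(r)-\left(-\frac{1}{8r}+\frac{1}{2p}\log\frac1r\right)\right|\le C\max\left\{1,\frac1{|p|}\log\frac1{|p|}\right\}. \] (The term with $\mathds{1}_{\{Tr\neq 0\}}$ is $0$ when $Tr=0$.)
   Context: $\{x\}=x-\lfloor x\rfloor$, and $S_N(\alpha)=\sum_{n=1}^N(\{n\alpha\}-1/2)$, $S_0(\alpha)=0$. For a rational $r$ whose denominator in reduced form is $q\ge1$, define \[ J_p(r)=\left(\sum_{N=0}^{q-1}e^{pS_N(r)}\right)^{1/p}\ (p\ne\pm\infty,0),\quad J_\infty(r)=\max_{0\le N<q}e^{S_N(r)},\quad J_{-\infty}(r)=\min_{0\le N<q}e^{S_N(r)}. \] The Gauss map $T:[0,1)\to[0,1)$ is $Tx=\{1/x\}$ for $x\ne0$ and $T0=0$; $T^2$ is its second iterate. For $r\in[0,1)\cap\mathbb{Q}$, $h_p(r)=\log\frac{J_p(r)}{J_p(T^2r)}$. Conventions for $p=\pm\infty$: $\frac1p=0$ and $\frac{1}{|p|}\log\frac{1}{|p|}=0$. *)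

theory Defs
  imports "HOL-Analysis.Analysis"
begin

definition birkhoff_S :: "nat \<Rightarrow> real \<Rightarrow> real" where
  "birkhoff_S N \<alpha> = (\<Sum>n=1..N. frac (real n * \<alpha>) - 1/2)"

text \<open>Denominator in reduced form; in particular it is 1 for integers.
  It is unspecified for irrational arguments.\<close>

definition rat_denom :: "real \<Rightarrow> nat" where
  "rat_denom r = (THE q. 0 < q \<and> (\<exists>a::int. coprime a (int q) \<and> r = real_of_int a / real q))"

lemma rat_denom_eqI:
  assumes "0 < q" "coprime a (int q)" "r = real_of_int a / real q"
  shows "rat_denom r = q"
  unfolding rat_denom_def
proof (rule the_equality)
  show "0 < q \<and> (\<exists>a::int. coprime a (int q) \<and> r = real_of_int a / real q)"
    using assms by blast
next
  fix q' assume "0 < q' \<and> (\<exists>a::int. coprime a (int q') \<and> r = real_of_int a / real q')"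
  then obtain b :: int where b: "0 < q'" "coprime b (int q')" "r = real_of_int b / real q'"
    by blast
  have "real_of_int a * real q' = real_of_int b * real q"
    using assms b by (simp add: field_simps)
  then have eq: "a * int q' = b * int q"
    by (metis of_int_eq_iff of_int_mult of_int_of_nat_eq)
  have "int q dvd a * int q'" "int q' dvd b * int q"
    by (simp add: eq, metis dvd_triv_right eq)
  then have "int q dvd int q'" "int q' dvd int q"
    using assms(2) b(2) by (meson coprime_commute coprime_dvd_mult_right_iff)+
  then show "q' = q"
    by (simp add: dvd_antisym)
qed

text \<open>The value at exponent 0 is irrelevant.\<close>

fun J :: "ereal \<Rightarrow> real \<Rightarrow> real" where
  "J (ereal p) r = (\<Sum>N<rat_denom r. exp (p * birkhoff_S N r)) powr (1 / p)"
| "J PInfty r = Max ((\<lambda>N. exp (birkhoff_S N r)) ` {..<rat_denom r})"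
| "J MInfty r = Min ((\<lambda>N. exp (birkhoff_S N r)) ` {..<rat_denom r})"

definition gauss_map :: "real \<Rightarrow> real" where
  "gauss_map x = (if x = 0 then 0 else frac (1 / x))"

definition h :: "ereal \<Rightarrow> real \<Rightarrow> real" where
  "h p r = ln (J p r / J p ((gauss_map ^^ 2) r))"

text \<open>The reciprocal \<open>1/p\<close> with the convention that it is 0 at \<open>\<plusminus>\<infinity>\<close>.\<close>

fun recip :: "ereal \<Rightarrow> real" where
  "recip (ereal p) = 1 / p"
| "recip PInfty = 0"
| "recip MInfty = 0"

text \<open>\<open>(1/|p|) log (1/|p|)\<close> with the convention that it is 0 at \<open>\<plusminus>\<infinity>\<close>.\<close>

fun recip_log :: "ereal \<Rightarrow> real" where
  "recip_log (ereal p) = 1 / \<bar>p\<bar> * ln (1 / \<bar>p\<bar>)"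
| "recip_log PInfty = 0"
| "recip_log MInfty = 0"

end

theory Submission
  imports Defs "HOL-Real_Asymp.Real_Asymp"
begin

text \<open>
  With \<open>M = \<lfloor>N r\<rfloor>\<close> and \<open>t = {N r}\<close>, the Birkhoff sums satisfy the exact reciprocity
  \<open>S\<^sub>N(r) = - S\<^sub>M(T r) - t (1 - t) / (2 r) + t / 2\<close>. Hence the partition function
  \<open>Z\<^sub>p(r) = \<Sum>\<^sub>N exp (p S\<^sub>N(r))\<close> is a sum of \<open>exp (- p S\<^sub>M(T r))\<close> over \<open>M\<close>, weighted by sums
  over \<open>r\<close>-spaced points \<open>t \<in> [0, 1)\<close>. If \<open>p > 0\<close> these weights are of geometric type
  and of order \<open>1\<close>; if \<open>p < 0\<close> they are Gaussian sums centred at \<open>t = 1/2\<close>, of order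
  \<open>exp (\<bar>p\<bar> / (8 r)) / sqrt r\<close>. Each step flips the sign of \<open>p\<close>, so two steps compare
  \<open>r\<close> with \<open>T\<^sup>2 r\<close>. The cases \<open>p = \<plusminus>\<infinity>\<close> are limits of finite exponents.
\<close>

section \<open>Reciprocity for Birkhoff sums\<close>

lemma birkhoff_S_0 [simp]: "birkhoff_S 0 x = 0"
  by (simp add: birkhoff_S_def)

lemma birkhoff_S_Suc:
  "birkhoff_S (Suc N) x = birkhoff_S N x + (frac (real (Suc N) * x) - 1/2)"
  by (simp add: birkhoff_S_def)

lemma frac_of_nat_mult_frac: "frac (real n * frac x) = frac (real n * x)"
proof -
  have "real n * x = real n * frac x + of_int (int n * \<lfloor>x\<rfloor>)"
    by (simp add: frac_def algebra_simps)
  then show ?thesis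
    by (simp add: frac_def)
qed

lemma birkhoff_S_frac: "birkhoff_S N (frac x) = birkhoff_S N x"
  unfolding birkhoff_S_def frac_of_nat_mult_frac ..

text \<open>Induction on \<open>N\<close>: each step moves the fractional part \<open>t\<close> by
  \<open>r\<close> around the unit circle. Either it stays below 1 and \<open>M\<close> is
  unchanged, or it wraps once and exactly one new summand enters the sum for \<open>1 / r\<close>.
  The quadratic correction is the one whose increments match \<open>t' - 1/2\<close> in both
  cases.\<close>

lemma birkhoff_S_reciprocity:
  fixes r :: real
  assumes r: "0 < r" "r < 1"
    and nonint: "\<And>n. 1 \<le> n \<Longrightarrow> n \<le> N \<Longrightarrow> real n * r \<notin> \<int>"
  shows "birkhoff_S N r = - birkhoff_S (nat \<lfloor>real N * r\<rfloor>) (1 / r)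
     - frac (real N * r) * (1 - frac (real N * r)) / (2 * r) + frac (real N * r) / 2"
  using nonint
proof (induction N)
  case 0
  then show ?case by simp
next
  case (Suc N)
  define t where "t = frac (real N * r)"
  define M where "M = nat \<lfloor>real N * r\<rfloor>"
  define t' where "t' = frac (real (Suc N) * r)"
  have IH: "birkhoff_S N r = - birkhoff_S M (1 / r) - t * (1 - t) / (2 * r) + t / 2"
    unfolding t_def M_def by (rule Suc.IH) (use Suc.prems in auto)
  have fl: "\<lfloor>real N * r\<rfloor> = int M" using r by (simp add: M_def)
  have Nr: "real N * r = real M + t" by (simp add: t_def frac_def fl)
  have t: "0 \<le> t" "t < 1" by (simp_all add: t_def frac_lt_1)
  have S: "birkhoff_S (Suc N) r = birkhoff_S N r + (t' - 1/2)"
    by (simp only: birkhoff_S_Suc t'_def)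
  show ?case
  proof (cases "t + r < 1")
    \<comment> \<open>No wrap: the quadratic expression alone grows by exactly
      \<open>t' - 1/2\<close>.\<close>
    case True
    have fl': "\<lfloor>real (Suc N) * r\<rfloor> = int M"
      by (rule floor_unique) (use Nr t r True in \<open>auto simp: algebra_simps\<close>)
    have t': "t' = t + r" unfolding t'_def frac_def fl' using Nr by (simp add: algebra_simps)
    have "- birkhoff_S M (1 / r) - t' * (1 - t') / (2 * r) + t' / 2
        = birkhoff_S N r + (t' - 1/2)"
      unfolding IH t' using r by (simp add: field_simps)
    then show ?thesis unfolding S fl' t'_def[symmetric] by simp
  next
    case False
    have fl': "\<lfloor>real (Suc N) * r\<rfloor> = int (Suc M)"
      by (rule floor_unique) (use Nr t r False in \<open>auto simp: algebra_simps\<close>)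
    have t': "t' = t + r - 1" unfolding t'_def frac_def fl' using Nr by (simp add: algebra_simps)
    \<comment> \<open>Integrality would break the formula here: with \<open>t' = 0\<close> the
      fractional part of \<open>(M + 1) / r\<close> would be 0 instead of
      \<open>1 - t' / r = 1\<close>.\<close>
    have "t' \<noteq> 0" unfolding t'_def using Suc.prems[of "Suc N"] by (simp add: frac_eq_0_iff)
    then have t'0: "0 < t'" "t' < r" using False t t' by auto
    have M': "real (Suc M) * (1 / r) = real (Suc N) - t' / r"
      using Nr r by (simp add: t' field_simps)
    have "\<lfloor>real (Suc M) * (1 / r)\<rfloor> = int N"
      unfolding M' by (rule floor_unique) (use t'0 in \<open>auto simp: field_simps\<close>)
    then have "frac (real (Suc M) * (1 / r)) = 1 - t' / r"
      unfolding frac_def M' by simp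
    then have SM: "birkhoff_S (Suc M) (1 / r) = birkhoff_S M (1 / r) + (1 - t' / r - 1/2)"
      by (simp only: birkhoff_S_Suc)
    have "- birkhoff_S (Suc M) (1 / r) - t' * (1 - t') / (2 * r) + t' / 2
        = birkhoff_S N r + (t' - 1/2)"
      unfolding IH SM t' using r by (simp add: field_simps)
    then show ?thesis unfolding S fl' t'_def[symmetric] by (simp only: nat_int)
  qed
qed

section \<open>Sums over equally spaced points of the unit interval\<close>

text \<open>The points \<open>N r - M\<close> for \<open>N\<close> in a fiber form an
  \<open>r\<close>-spaced progression in [0,1). No upper bound on \<open>N\<close> is imposed, so
  that the weight estimates below hold for every \<open>M\<close>, uniformly.\<close>

definition fiber :: "real \<Rightarrow> nat \<Rightarrow> nat set" where
  "fiber r M = {N. \<lfloor>real N * r\<rfloor> = int M}"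

lemma finite_fiber:
  assumes "0 < r" shows "finite (fiber r M)"
proof (rule finite_subset)
  show "fiber r M \<subseteq> {..nat \<lceil>(real M + 1) / r\<rceil>}"
  proof
    fix N assume "N \<in> fiber r M"
    then have "real N * r < real M + 1"
      unfolding fiber_def by (simp add: floor_eq_iff)
    then have "real N < (real M + 1) / r" using assms by (simp add: field_simps)
    then show "N \<in> {..nat \<lceil>(real M + 1) / r\<rceil>}" by simp linarith
  qed
qed simp

lemma frac_fiber: "N \<in> fiber r M \<Longrightarrow> frac (real N * r) = real N * r - real M"
  by (simp add: fiber_def frac_def)

text \<open>Rounding \<open>d x / r\<close> down sends separated points to distinct indices and,
  \<open>f\<close> being antitone, only increases the terms. Nonnegativity then permits filling in
  the missing indices.\<close>

lemma sum_separated_le: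
  fixes d :: "'a \<Rightarrow> real" and f :: "real \<Rightarrow> real"
  assumes fin: "finite X" and r: "0 < r"
    and d0: "\<And>x. x \<in> X \<Longrightarrow> 0 \<le> d x"
    and sep: "\<And>x y. x \<in> X \<Longrightarrow> y \<in> X \<Longrightarrow> x \<noteq> y \<Longrightarrow> r \<le> \<bar>d x - d y\<bar>"
    and anti: "\<And>x y. 0 \<le> x \<Longrightarrow> x \<le> y \<Longrightarrow> f y \<le> f x"
    and f0: "\<And>x. 0 \<le> f x"
    and bound: "\<And>n. (\<Sum>j<n. f (r * real j)) \<le> B"
  shows "(\<Sum>x\<in>X. f (d x)) \<le> B"
proof -
  define g where "g x = nat \<lfloor>d x / r\<rfloor>" for x
  have g: "real (g x) \<le> d x / r" "d x / r < real (g x) + 1" if "x \<in> X" for x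
  proof -
    have "0 \<le> d x / r" using d0[OF that] r by simp
    then show "real (g x) \<le> d x / r" "d x / r < real (g x) + 1"
      unfolding g_def by linarith+
  qed
  have inj: "inj_on g X"
  proof (rule inj_onI, rule ccontr)
    fix x y assume xy: "x \<in> X" "y \<in> X" "g x = g y" "x \<noteq> y"
    have "\<bar>d x / r - d y / r\<bar> < 1" using g[OF xy(1)] g[OF xy(2)] xy(3) by linarith
    then have "\<bar>d x - d y\<bar> < r"
      using r by (simp add: diff_divide_distrib[symmetric] abs_divide field_simps)
    with sep[OF xy(1,2,4)] show False by simp
  qed
  obtain n where n: "g ` X \<subseteq> {..<n}" using finite_imageI[OF fin] finite_nat_iff_bounded by blast
  have "(\<Sum>x\<in>X. f (d x)) \<le> (\<Sum>x\<in>X. f (r * real (g x)))"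
  proof (rule sum_mono)
    fix x assume "x \<in> X"
    then show "f (d x) \<le> f (r * real (g x))"
      using g(1)[of x] r by (intro anti) (auto simp: field_simps)
  qed
  also have "\<dots> = (\<Sum>j\<in>g ` X. f (r * real j))"
    by (simp add: sum.reindex[OF inj])
  also have "\<dots> \<le> (\<Sum>j<n. f (r * real j))"
    using n f0 by (intro sum_mono2) auto
  also have "\<dots> \<le> B" by (rule bound)
  finally show ?thesis .
qed

text \<open>The exponent \<open>t (1 - t)\<close> is monotone only on each half of the unit
  interval, so each half of a fiber is treated separately. There \<open>b + c t\<close> with
  \<open>c\<close> equal to 1 or -1 serves as the distance to an endpoint or to the centre.\<close>

lemma sum_fiber_half_le:
  fixes c :: real and f :: "real \<Rightarrow> real"
  assumes r: "0 < r" and X: "X \<subseteq> fiber r M" and c: "\<bar>c\<bar> = 1"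
    and d0: "\<And>N. N \<in> X \<Longrightarrow> 0 \<le> b + c * frac (real N * r)"
    and anti: "\<And>x y. 0 \<le> x \<Longrightarrow> x \<le> y \<Longrightarrow> f y \<le> f x"
    and f0: "\<And>x. 0 \<le> f x"
    and bound: "\<And>n. (\<Sum>j<n. f (r * real j)) \<le> B"
  shows "(\<Sum>N\<in>X. f (b + c * frac (real N * r))) \<le> B"
proof (rule sum_separated_le[where r = r and f = f and d = "\<lambda>N. b + c * frac (real N * r)"])
  show "finite X" using finite_subset[OF X finite_fiber[OF r]] .
next
  fix x y assume "x \<in> X" "y \<in> X" "x \<noteq> y"
  then have "x \<in> fiber r M" "y \<in> fiber r M" using X by auto
  then have "b + c * frac (real x * r) - (b + c * frac (real y * r)) = c * (real x - real y) * r"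
    unfolding frac_fiber[OF \<open>x \<in> fiber r M\<close>] frac_fiber[OF \<open>y \<in> fiber r M\<close>]
    by (simp add: algebra_simps)
  moreover have "1 \<le> \<bar>real x - real y\<bar>" using \<open>x \<noteq> y\<close> by linarith
  ultimately show "r \<le> \<bar>b + c * frac (real x * r) - (b + c * frac (real y * r))\<bar>"
    using r c by (simp add: abs_mult)
qed (fact r d0 anti f0 bound)+

section \<open>Geometric and Gaussian sums, and the resulting weights of a fiber\<close>

lemma sum_geometric_le:
  fixes P :: real
  assumes P: "0 < P"
  shows "(\<Sum>j<n. exp (- P * real j)) \<le> 1 + 1 / P"
proof -
  have e: "exp (- P) < 1" using P by simp
  have "(\<Sum>j<n. exp (- P * real j)) = (\<Sum>j<n. exp (- P) ^ j)"
    by (simp add: exp_of_nat_mult[symmetric] mult.commute)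
  also have "\<dots> = (1 - exp (- P) ^ n) / (1 - exp (- P))"
    using e by (simp add: sum_gp_strict)
  also have "\<dots> \<le> 1 / (1 - exp (- P))"
    using e by (intro divide_right_mono) auto
  \<comment> \<open>Equivalent to \<open>exp P \<ge> 1 + P\<close>.\<close>
  also have "\<dots> \<le> 1 + 1 / P"
  proof -
    have "1 + P \<le> exp P" by (rule exp_ge_add_one_self)
    then have "exp (- P) \<le> 1 / (1 + P)" using P by (simp add: exp_minus field_simps)
    then have "P / (1 + P) \<le> 1 - exp (- P)" using P by (simp add: field_simps)
    then have "1 / (1 - exp (- P)) \<le> 1 / (P / (1 + P))"
      using P by (intro divide_left_mono) (auto intro!: mult_pos_pos)
    also have "\<dots> = 1 + 1 / P" using P by (simp add: field_simps)
    finally show ?thesis .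
  qed
  finally show ?thesis .
qed

text \<open>Since \<open>exp (-y\<^sup>2) \<le> 2 / (1 + y)\<^sup>2\<close>, the term at \<open>y = \<delta> j\<close> is at most \<open>2 / \<delta>\<close> times the
  telescoping difference \<open>1 / (1 + \<delta> (j - 1)) - 1 / (1 + \<delta> j)\<close>.\<close>

lemma sum_gaussian_le:
  fixes \<delta> :: real
  assumes \<delta>: "0 < \<delta>"
  shows "(\<Sum>j<n. exp (- ((\<delta> * real j)\<^sup>2))) \<le> 2 + 2 / \<delta>"
proof -
  \<comment> \<open>The induction starts at \<open>n = 1\<close>, because at \<open>n = 0\<close>
    the denominator contains \<open>1 - \<delta>\<close>, which need not be positive.\<close>
  have tele: "(\<Sum>j<n. exp (- ((\<delta> * real j)\<^sup>2))) + 2 / (\<delta> * (1 + \<delta> * (real n - 1))) \<le> 2 + 2 / \<delta>"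
    if "1 \<le> n" for n
    using that
  proof (induction n rule: dec_induct)
    case base
    then show ?case by simp
  next
    case (step n)
    define y where "y = \<delta> * real n"
    have y: "\<delta> \<le> y" using step \<delta> by (simp add: y_def)
    have "1 + y\<^sup>2 \<le> exp (y\<^sup>2)" by (rule exp_ge_add_one_self)
    moreover have "(1 + y)\<^sup>2 \<le> 2 * (1 + y\<^sup>2)"
      using zero_le_power2[of "1 - y"] by (simp add: power2_eq_square algebra_simps)
    ultimately have "(1 + y)\<^sup>2 \<le> 2 * exp (y\<^sup>2)" by (meson mult_left_mono order_trans zero_le_numeral)
    then have "exp (- (y\<^sup>2)) \<le> 2 / (1 + y)\<^sup>2"
      using y \<delta> by (simp add: exp_minus field_simps)
    also have "\<dots> \<le> 2 / ((1 + y) * (1 + y - \<delta>))"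
      using y \<delta> by (intro divide_left_mono) (auto simp: power2_eq_square intro!: mult_left_mono)
    also have "\<dots> = 2 / (\<delta> * (1 + y - \<delta>)) - 2 / (\<delta> * (1 + y))"
      using y \<delta> by (simp add: divide_simps)
    finally have "exp (- (y\<^sup>2)) + 2 / (\<delta> * (1 + y)) \<le> 2 / (\<delta> * (1 + y - \<delta>))" by simp
    then show ?case using step.IH by (simp add: y_def algebra_simps)
  qed
  show ?thesis
  proof (cases "n = 0")
    case True
    then show ?thesis using \<delta> by simp
  next
    case False
    then have "0 \<le> 2 / (\<delta> * (1 + \<delta> * (real n - 1)))" using \<delta> by simp
    with tele[of n] False show ?thesis by linarith
  qed
qed

text \<open>\<open>t (1 - t)\<close> is at least half the distance from \<open>t\<close> to the
  nearer endpoint. Each half of the fiber is therefore dominated by a geometric series of ratio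
  \<open>exp (- P / 4)\<close>, and the two together give \<open>2 + 8 / P\<close>.\<close>

lemma fiber_geometric_le:
  assumes r: "0 < r" and P: "0 < P"
  shows "(\<Sum>N\<in>fiber r M. exp (- P * (frac (real N * r) * (1 - frac (real N * r)) / (2 * r))))
    \<le> 10 * max 1 (1 / P)"
proof -
  let ?t = "\<lambda>N. frac (real N * r)"
  let ?f = "\<lambda>x. exp (- P * (x / (4 * r)))"
  define A where "A = {N \<in> fiber r M. ?t N \<le> 1/2}"
  define A' where "A' = {N \<in> fiber r M. \<not> ?t N \<le> 1/2}"
  have split: "fiber r M = A \<union> A'" "A \<inter> A' = {}" by (auto simp: A_def A'_def)
  have fin: "finite A" "finite A'" using finite_fiber[OF r, of M] by (auto simp: A_def A'_def)
  have B: "(\<Sum>j<n. ?f (r * real j)) \<le> 1 + 1 / (P / 4)" for n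
    using sum_geometric_le[of "P / 4" n] P r by simp
  have anti: "?f y \<le> ?f x" if "x \<le> y" for x y
    using that P r by (simp add: divide_right_mono)
  have t: "0 \<le> ?t N" "?t N < 1" for N by (simp_all add: frac_lt_1)
  have le: "exp (- P * (u * v / (2 * r))) \<le> ?f u" if "0 \<le> u" "1/2 \<le> v" for u v
  proof -
    have "u * (1/2) \<le> u * v" using that by (intro mult_left_mono) auto
    then have "u / (4 * r) \<le> u * v / (2 * r)" using r by (simp add: field_simps)
    then have "P * (u / (4 * r)) \<le> P * (u * v / (2 * r))" using P by (intro mult_left_mono) auto
    then show ?thesis by simp
  qed
  have "(\<Sum>N\<in>A. exp (- P * (?t N * (1 - ?t N) / (2 * r)))) \<le> (\<Sum>N\<in>A. ?f (0 + 1 * ?t N))"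
    using t by (intro sum_mono) (use le in \<open>auto simp: A_def\<close>)
  also have "\<dots> \<le> 1 + 1 / (P / 4)"
    by (rule sum_fiber_half_le[OF r _ _ _ anti _ B, where M = M]) (use t in \<open>auto simp: A_def\<close>)
  finally have 1: "(\<Sum>N\<in>A. exp (- P * (?t N * (1 - ?t N) / (2 * r)))) \<le> 1 + 1 / (P / 4)" .
  have "(\<Sum>N\<in>A'. exp (- P * (?t N * (1 - ?t N) / (2 * r)))) \<le> (\<Sum>N\<in>A'. ?f (1 + (- 1) * ?t N))"
  proof (rule sum_mono)
    fix N assume "N \<in> A'"
    then show "exp (- P * (?t N * (1 - ?t N) / (2 * r))) \<le> ?f (1 + (- 1) * ?t N)"
      using le[of "1 - ?t N" "?t N"] t[of N] by (simp add: A'_def mult.commute)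
  qed
  also have "\<dots> \<le> 1 + 1 / (P / 4)"
    by (rule sum_fiber_half_le[OF r _ _ _ anti _ B, where M = M])
      (use t in \<open>auto simp: A'_def less_imp_le\<close>)
  finally have 2: "(\<Sum>N\<in>A'. exp (- P * (?t N * (1 - ?t N) / (2 * r)))) \<le> 1 + 1 / (P / 4)" .
  show ?thesis
    unfolding split(1) sum.union_disjoint[OF fin split(2)] using 1 2 by simp
qed

text \<open>Since \<open>t (1 - t) = 1/4 - (t - 1/2)\<^sup>2\<close>, the factor
  \<open>exp (P / (8 r))\<close> splits off and a Gaussian in the distance to 1/2 remains, summed on
  either side of the centre.\<close>

lemma fiber_gaussian_le:
  assumes r: "0 < r" "r < 1" and P: "0 < P"
  shows "(\<Sum>N\<in>fiber r M. exp (P * (frac (real N * r) * (1 - frac (real N * r)) / (2 * r))))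
    \<le> exp (P / (8 * r)) / sqrt r * (10 * max 1 (1 / P))"
proof -
  let ?t = "\<lambda>N. frac (real N * r)"
  let ?f = "\<lambda>x. exp (- (P * x\<^sup>2 / (2 * r)))"
  define A where "A = {N \<in> fiber r M. ?t N \<le> 1/2}"
  define A' where "A' = {N \<in> fiber r M. \<not> ?t N \<le> 1/2}"
  have split: "fiber r M = A \<union> A'" "A \<inter> A' = {}" by (auto simp: A_def A'_def)
  have fin: "finite A" "finite A'" using finite_fiber[OF r(1), of M] by (auto simp: A_def A'_def)
  \<comment> \<open>Rescaled spacing: it turns the exponent \<open>P (r j)\<^sup>2 / (2 r)\<close>
    into \<open>(\<delta> j)\<^sup>2\<close>.\<close>
  define \<delta> where "\<delta> = sqrt (P * r / 2)"
  have \<delta>: "0 < \<delta>" using P r by (simp add: \<delta>_def)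
  have B: "(\<Sum>j<n. ?f (r * real j)) \<le> 2 + 2 / \<delta>" for n
  proof -
    have "P * (r * real j)\<^sup>2 / (2 * r) = (\<delta> * real j)\<^sup>2" for j
      using P r by (simp add: \<delta>_def power_mult_distrib) (simp add: power2_eq_square)
    then show ?thesis using sum_gaussian_le[OF \<delta>, of n] by simp
  qed
  have anti: "?f y \<le> ?f x" if "0 \<le> x" "x \<le> y" for x y
    using that P r by (simp add: divide_right_mono power_mono)
  have eq: "exp (P * (u * (1 - u) / (2 * r))) = exp (P / (8 * r)) * ?f (1/2 + (- 1) * u)"
    "exp (P * (u * (1 - u) / (2 * r))) = exp (P / (8 * r)) * ?f (- (1/2) + 1 * u)" for u
    using r by (auto simp: exp_add[symmetric] power2_eq_square field_simps)
  have "(\<Sum>N\<in>A. ?f (1/2 + (- 1) * ?t N)) \<le> 2 + 2 / \<delta>"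
    by (rule sum_fiber_half_le[OF r(1) _ _ _ anti _ B, where M = M]) (auto simp: A_def)
  then have 1: "(\<Sum>N\<in>A. exp (P * (?t N * (1 - ?t N) / (2 * r)))) \<le> exp (P / (8 * r)) * (2 + 2 / \<delta>)"
    by (simp only: eq(1) sum_distrib_left[symmetric] mult_le_cancel_left_pos exp_gt_zero)
  have "(\<Sum>N\<in>A'. ?f (- (1/2) + 1 * ?t N)) \<le> 2 + 2 / \<delta>"
    by (rule sum_fiber_half_le[OF r(1) _ _ _ anti _ B, where M = M]) (auto simp: A'_def)
  then have 2: "(\<Sum>N\<in>A'. exp (P * (?t N * (1 - ?t N) / (2 * r)))) \<le> exp (P / (8 * r)) * (2 + 2 / \<delta>)"
    by (simp only: eq(2) sum_distrib_left[symmetric] mult_le_cancel_left_pos exp_gt_zero)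
  \<comment> \<open>Both halves contribute \<open>2 + 2 / \<delta>\<close>. The bound
    \<open>sqrt 2 \<le> 3/2\<close> makes the term \<open>4 / \<delta>\<close> cost 6, and the
    constant 4 costs the other 4 of the 10.\<close>
  have 3: "4 + 4 / \<delta> \<le> 10 * max 1 (1 / P) / sqrt r"
  proof -
    let ?m = "max 1 (1 / P)"
    have m: "1 / sqrt P \<le> ?m"
    proof (cases "1 \<le> P")
      case True
      then show ?thesis by (simp add: le_max_iff_disj)
    next
      case False
      then have "sqrt P * sqrt P \<le> sqrt P * 1" using P by (intro mult_left_mono) auto
      then have "1 / sqrt P \<le> 1 / P" using P by (simp add: field_simps)
      then show ?thesis by (simp add: le_max_iff_disj)
    qed
    have s2: "sqrt 2 \<le> 3/2" by (rule real_le_lsqrt) (auto simp: power2_eq_square)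
    have "1 / \<delta> = sqrt 2 * (1 / sqrt P) / sqrt r"
      by (simp add: \<delta>_def real_sqrt_mult real_sqrt_divide)
    also have "\<dots> \<le> (3/2) * ?m / sqrt r"
      using r s2 m P by (intro divide_right_mono mult_mono) auto
    finally have a: "1 / \<delta> \<le> (3/2) * ?m / sqrt r" .
    have "1 * 1 \<le> ?m * (1 / sqrt r)" using r by (intro mult_mono) auto
    then have "1 \<le> ?m / sqrt r" by simp
    with a show ?thesis by simp
  qed
  have "(\<Sum>N\<in>fiber r M. exp (P * (?t N * (1 - ?t N) / (2 * r)))) \<le> exp (P / (8 * r)) * (4 + 4 / \<delta>)"
    unfolding split(1) sum.union_disjoint[OF fin split(2)] using 1 2 by (simp add: algebra_simps)
  also have "\<dots> \<le> exp (P / (8 * r)) * (10 * max 1 (1 / P) / sqrt r)"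
    using 3 by (intro mult_left_mono) auto
  finally show ?thesis by simp
qed

text \<open>One term is enough: the first point of the fiber has \<open>t < r\<close>, so
  \<open>t (1 - t) / (2 r)\<close> is at most 1/2.\<close>

lemma fiber_geometric_ge:
  assumes r: "0 < r" "r < 1" and P: "0 < P"
  shows "exp (- P / 2)
    \<le> (\<Sum>N\<in>fiber r M. exp (- P * (frac (real N * r) * (1 - frac (real N * r)) / (2 * r))))"
proof -
  define N where "N = nat \<lceil>real M / r\<rceil>"
  have "0 \<le> real M / r" using r by simp
  then have N: "real M / r \<le> real N" "real N < real M / r + 1" unfolding N_def by linarith+
  then have N': "real M \<le> real N * r" "real N * r < real M + r" using r by (auto simp: field_simps)
  have mem: "N \<in> fiber r M"
    unfolding fiber_def mem_Collect_eq by (rule floor_unique) (use N' r in auto)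
  define t where "t = frac (real N * r)"
  have t: "0 \<le> t" "t < r" using N' frac_fiber[OF mem] by (simp_all add: t_def)
  have "t * (1 - t) \<le> r * 1" using t r by (intro mult_mono) auto
  then have "t * (1 - t) / (2 * r) \<le> 1 / 2" using r by (simp add: field_simps)
  then have "P * (t * (1 - t) / (2 * r)) \<le> P * (1 / 2)" using P by (intro mult_left_mono) auto
  then have "exp (- P / 2) \<le> exp (- P * (t * (1 - t) / (2 * r)))" by simp
  also have "\<dots> \<le> (\<Sum>N\<in>fiber r M. exp (- P * (frac (real N * r) * (1 - frac (real N * r)) / (2 * r))))"
    unfolding t_def by (rule member_le_sum[OF mem]) (auto simp: finite_fiber r)
  finally show ?thesis .
qed

text \<open>The points with \<open>\<bar>t - 1/2\<bar> \<le> sqrt r / 2\<close> already suffice: there are at least \<open>\<lfloor>1 / sqrt r\<rfloor>\<close>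
  of them.\<close>

lemma fiber_gaussian_ge:
  assumes r: "0 < r" "r < 1" and P: "0 < P"
  shows "exp (P / (8 * r)) / sqrt r * (exp (- P / 8) / 2)
    \<le> (\<Sum>N\<in>fiber r M. exp (P * (frac (real N * r) * (1 - frac (real N * r)) / (2 * r))))"
proof -
  let ?t = "\<lambda>N. frac (real N * r)"
  define w where "w = sqrt r"
  have w: "0 < w" "w < 1" "w * w = r" using r by (auto simp: w_def)
  \<comment> \<open>\<open>a\<close> is the real index at which \<open>t\<close> enters the window
    of width \<open>w\<close> about 1/2. The \<open>k\<close> consecutive integers from its ceiling
    on stay inside, because \<open>k r \<le> w\<close>.\<close>
  define a where "a = (real M + 1/2 - w/2) / r"
  define n where "n = nat \<lceil>a\<rceil>"
  define k where "k = nat \<lfloor>1 / w\<rfloor>"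
  have "0 \<le> a" using w r by (simp add: a_def)
  then have n: "a \<le> real n" "real n < a + 1" unfolding n_def by linarith+
  have w1: "1 < 1 / w" using w by simp
  then have "1 \<le> \<lfloor>1 / w\<rfloor>" by (simp add: le_floor_iff)
  then have k: "1 \<le> real k" "real k \<le> 1 / w" "1 / w < real k + 1"
    unfolding k_def by linarith+
  have mem: "N \<in> fiber r M \<and> \<bar>?t N - 1/2\<bar> \<le> w / 2" if "N \<in> {n..<n+k}" for N
  proof -
    have "a \<le> real N" using that n by simp
    then have lo: "real M + 1/2 - w/2 \<le> real N * r" using r by (simp add: a_def field_simps)
    have "real N \<le> real n + real k - 1" using that by auto
    then have "real N < a + 1 / w" using n k by linarith
    then have "real N * r < (a + 1 / w) * r" using r by simp
    also have "\<dots> = real M + 1/2 + w/2" using r w by (simp add: a_def field_simps)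
    finally have hi: "real N * r < real M + 1/2 + w/2" .
    have "N \<in> fiber r M"
      unfolding fiber_def mem_Collect_eq by (rule floor_unique) (use lo hi w in auto)
    moreover from lo hi have "\<bar>?t N - 1/2\<bar> \<le> w / 2"
      unfolding frac_fiber[OF calculation] by linarith
    ultimately show ?thesis ..
  qed
  have "exp (P / (8 * r)) / sqrt r * (exp (- P / 8) / 2) = (1 / w / 2) * exp (P / (8 * r) - P / 8)"
    by (simp add: w_def exp_add[symmetric])
  \<comment> \<open>From \<open>k \<ge> 1\<close> and \<open>k + 1 > 1 / w\<close> follows
    \<open>k \<ge> 1 / (2 w)\<close>; this is the source of the factor 1/2.\<close>
  also have "\<dots> \<le> real k * exp (P / (8 * r) - P / 8)"
    using k by (intro mult_right_mono) auto
  also have "\<dots> = (\<Sum>N\<in>{n..<n+k}. exp (P / (8 * r) - P / 8))" by simp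
  also have "\<dots> \<le> (\<Sum>N\<in>{n..<n+k}. exp (P * (?t N * (1 - ?t N) / (2 * r))))"
  proof (rule sum_mono)
    fix N assume "N \<in> {n..<n+k}"
    then have "\<bar>?t N - 1/2\<bar> \<le> \<bar>w / 2\<bar>" using mem w by auto
    then have "(?t N - 1/2)\<^sup>2 \<le> (w / 2)\<^sup>2" by (simp only: abs_le_square_iff)
    then have "1/4 - r/4 \<le> ?t N * (1 - ?t N)"
      using w by (simp add: power2_eq_square algebra_simps)
    then have "(1/4 - r/4) / (2 * r) \<le> ?t N * (1 - ?t N) / (2 * r)"
      using r by (intro divide_right_mono) auto
    then have "P * ((1/4 - r/4) / (2 * r)) \<le> P * (?t N * (1 - ?t N) / (2 * r))"
      using P by (intro mult_left_mono) auto
    moreover have "P * ((1/4 - r/4) / (2 * r)) = P / (8 * r) - P / 8"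
      using r by (simp add: field_simps)
    ultimately show "exp (P / (8 * r) - P / 8) \<le> exp (P * (?t N * (1 - ?t N) / (2 * r)))" by simp
  qed
  also have "\<dots> \<le> (\<Sum>N\<in>fiber r M. exp (P * (?t N * (1 - ?t N) / (2 * r))))"
    using mem by (intro sum_mono2 finite_fiber r) auto
  finally show ?thesis .
qed

section \<open>The partition function\<close>

definition Z :: "real \<Rightarrow> real \<Rightarrow> real" where
  "Z p r = (\<Sum>N<rat_denom r. exp (p * birkhoff_S N r))"

lemma rat_denom_frac_nat:
  assumes "0 < q" "coprime a q"
  shows "rat_denom (real a / real q) = q"
  using assms by (intro rat_denom_eqI[of _ "int a"]) auto

lemma obtain_reduced_fraction:
  assumes "r \<in> {0<..<1} \<inter> \<rat>"
  obtains a q :: nat where "0 < a" "a < q" "coprime a q" "r = real a / real q"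
proof -
  from assms have "r \<in> \<rat>" "0 < r" "r < 1" by auto
  from \<open>r \<in> \<rat>\<close> obtain a q :: nat where aq: "q \<noteq> 0" "\<bar>r\<bar> = real a / real q" "coprime a q"
    by (rule Rats_abs_nat_div_natE)
  have r: "r = real a / real q" using aq(2) \<open>0 < r\<close> by simp
  show thesis
    using that[of a q] aq(1,3) r \<open>0 < r\<close> \<open>r < 1\<close> by (auto simp: zero_less_divide_iff)
qed

text \<open>One division step of the Euclidean algorithm: the numerator becomes the new
  denominator.\<close>

lemma gauss_map_fraction:
  assumes "0 < a"
  shows "gauss_map (real a / real q) = real (q mod a) / real a"
proof (cases "q = 0")
  case False
  have "frac (real q / real a) = real (q mod a) / real a"
  proof -
    have "\<lfloor>real q / real a\<rfloor> = int (q div a)" by (simp add: floor_divide_of_nat_eq)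
    moreover have "real q = real (q div a) * real a + real (q mod a)"
      by (metis div_mult_mod_eq of_nat_add of_nat_mult)
    ultimately show ?thesis using assms by (simp add: frac_def field_simps)
  qed
  then show ?thesis using assms False by (simp add: gauss_map_def)
qed (simp add: gauss_map_def)

lemma gauss_map_range: "0 \<le> gauss_map r" "gauss_map r < 1"
  by (auto simp: gauss_map_def frac_lt_1)

lemma gauss_map_Rats:
  assumes "r \<in> {0<..<1} \<inter> \<rat>" "gauss_map r \<noteq> 0"
  shows "gauss_map r \<in> {0<..<1} \<inter> \<rat>"
proof -
  obtain a q :: nat where aq: "0 < a" "a < q" "coprime a q" "r = real a / real q"
    by (rule obtain_reduced_fraction[OF assms(1)])
  have "gauss_map r \<in> \<rat>" unfolding aq(4) gauss_map_fraction[OF aq(1)] by simp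
  with assms(2) gauss_map_range[of r] show ?thesis by auto
qed

lemma rat_denom_0: "rat_denom 0 = 1"
  by (rule rat_denom_eqI[of _ 0]) auto

lemma rat_denom_pos:
  assumes "r \<in> {0<..<1} \<inter> \<rat> \<or> r = 0"
  shows "0 < rat_denom r"
proof (cases "r = 0")
  case False
  with assms obtain a q :: nat where "0 < a" "a < q" "coprime a q" "r = real a / real q"
    using obtain_reduced_fraction by blast
  then show ?thesis by (simp add: rat_denom_frac_nat)
qed (simp add: rat_denom_0)

lemma Z_0 [simp]: "Z p 0 = 1"
  by (simp add: Z_def rat_denom_0)

lemma Z_pos:
  assumes "r \<in> {0<..<1} \<inter> \<rat> \<or> r = 0"
  shows "0 < Z p r"
  unfolding Z_def using rat_denom_pos[OF assms] by (intro sum_pos) (auto intro: lessThan_empty_iff)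

text \<open>For \<open>r = a / q\<close> in lowest terms, the indices \<open>N < q\<close> are
  grouped by \<open>M = \<lfloor>N r\<rfloor>\<close>, which runs over \<open>M < a\<close>, and
  \<open>a\<close> is the denominator of \<open>T r\<close>. Reciprocity factors every summand. The
  factor \<open>exp (p t / 2)\<close> is kept apart because it lies between
  \<open>exp (- \<bar>p\<bar> / 2)\<close> and \<open>exp (\<bar>p\<bar> / 2)\<close>.\<close>

lemma Z_step:
  assumes r: "r \<in> {0<..<1} \<inter> \<rat>"
  shows "Z p r = (\<Sum>M<rat_denom (gauss_map r). exp (- p * birkhoff_S M (gauss_map r)) *
    (\<Sum>N\<in>fiber r M. exp (- p * (frac (real N * r) * (1 - frac (real N * r)) / (2 * r)))
        * exp (p * frac (real N * r) / 2)))"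
proof -
  obtain a q :: nat where aq: "0 < a" "a < q" "coprime a q" "r = real a / real q"
    by (rule obtain_reduced_fraction[OF r])
  have r01: "0 < r" "r < 1" using r by auto
  have rq: "r * real q = real a" using aq by simp
  have dr: "rat_denom r = q" unfolding aq(4) using aq by (intro rat_denom_frac_nat) auto
  have dT: "rat_denom (gauss_map r) = a"
    unfolding aq(4) gauss_map_fraction[OF aq(1)] using aq
    by (intro rat_denom_frac_nat) (auto simp: coprime_commute)
  have nonint: "real n * r \<notin> \<int>" if n: "1 \<le> n" "n < q" for n
  proof
    assume "real n * r \<in> \<int>"
    then obtain m :: int where "real n * r = of_int m" by (elim Ints_cases)
    then have "real n * real a = of_int m * real q" unfolding aq(4) using aq by (simp add: field_simps)
    then have "int n * int a = m * int q" by (metis of_int_eq_iff of_int_mult of_int_of_nat_eq)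
    then have "int q dvd int n * int a" by simp
    then have "q dvd n * a" by (metis int_dvd_int_iff of_nat_mult)
    then have "q dvd n" using aq(3) by (simp add: coprime_commute coprime_dvd_mult_left_iff)
    then show False using n by (auto dest: dvd_imp_le)
  qed
  define F where "F N = exp (p * birkhoff_S N r)" for N
  define m where "m N = nat \<lfloor>real N * r\<rfloor>" for N
  have m_less: "m N < a" if "N < q" for N
  proof -
    have "real N * r < real q * r" using that r01 by simp
    then show ?thesis using r01 rq by (simp add: m_def nat_less_iff floor_less_iff mult.commute)
  qed
  \<comment> \<open>The bound \<open>N < q\<close> is automatic on these fibers:
    \<open>N r < M + 1 \<le> a = q r\<close>.\<close>
  have fib: "{N \<in> {..<q}. m N = M} = fiber r M" if "M < a" for M
  proof -
    have "N < q" if "N \<in> fiber r M" for N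
    proof -
      have "real N * r < real M + 1" using that by (simp add: fiber_def floor_eq_iff)
      also have "\<dots> \<le> real q * r" using \<open>M < a\<close> rq by (simp add: mult.commute)
      finally show ?thesis using r01 by simp
    qed
    then show ?thesis using r01 by (auto simp: fiber_def m_def)
  qed
  have "Z p r = (\<Sum>N<q. F N)" by (simp add: Z_def dr F_def)
  also have "\<dots> = (\<Sum>M<a. \<Sum>N\<in>{N \<in> {..<q}. m N = M}. F N)"
    by (rule sum.group[symmetric]) (use m_less in auto)
  also have "\<dots> = (\<Sum>M<a. \<Sum>N\<in>fiber r M. F N)"
    by (intro sum.cong refl fib) auto
  also have "\<dots> = (\<Sum>M<a. exp (- p * birkhoff_S M (gauss_map r)) *
    (\<Sum>N\<in>fiber r M. exp (- p * (frac (real N * r) * (1 - frac (real N * r)) / (2 * r)))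
        * exp (p * frac (real N * r) / 2)))"
    unfolding sum_distrib_left
  proof (intro sum.cong refl)
    fix M N assume M: "M \<in> {..<a}" and N: "N \<in> fiber r M"
    let ?t = "frac (real N * r)"
    have Nq: "N < q" and mN: "m N = M" using fib[of M] M N by auto
    have "gauss_map r = frac (1 / r)" using r01 by (simp add: gauss_map_def)
    then have S: "birkhoff_S M (gauss_map r) = birkhoff_S M (1 / r)" by (simp add: birkhoff_S_frac)
    have "birkhoff_S N r = - birkhoff_S M (1 / r) - ?t * (1 - ?t) / (2 * r) + ?t / 2"
      using birkhoff_S_reciprocity[OF r01, of N] nonint Nq mN by (simp add: m_def)
    moreover have "p * (- A - B + C / 2) = - p * A + (- p * B + p * C / 2)" for A B C :: real
      by (simp add: algebra_simps)
    ultimately show "F N = exp (- p * birkhoff_S M (gauss_map r)) *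
        (exp (- p * (?t * (1 - ?t) / (2 * r))) * exp (p * ?t / 2))"
      unfolding F_def S exp_add[symmetric] by (simp only:)
  qed
  finally show ?thesis by (simp add: dT)
qed

text \<open>Bounds on the weights that are uniform in \<open>M\<close> come out of the outer sum,
  and what is left of it is the partition function of \<open>T r\<close> at the opposite
  exponent.\<close>

lemma Z_step_bounds:
  assumes r: "r \<in> {0<..<1} \<inter> \<rat>"
    and lo: "\<And>M. l \<le> (\<Sum>N\<in>fiber r M. exp (- p * (frac (real N * r) * (1 - frac (real N * r)) / (2 * r))))"
    and hi: "\<And>M. (\<Sum>N\<in>fiber r M. exp (- p * (frac (real N * r) * (1 - frac (real N * r)) / (2 * r)))) \<le> u"
  shows "Z (- p) (gauss_map r) * (l * exp (- \<bar>p\<bar> / 2)) \<le> Z p r"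
    and "Z p r \<le> Z (- p) (gauss_map r) * (u * exp (\<bar>p\<bar> / 2))"
proof -
  let ?g = "\<lambda>N. exp (- p * (frac (real N * r) * (1 - frac (real N * r)) / (2 * r)))"
  have tb: "\<bar>p * frac (real N * r) / 2\<bar> \<le> \<bar>p\<bar> / 2" for N
    using mult_left_mono[of "frac (real N * r)" 1 "\<bar>p\<bar>"] frac_lt_1[of "real N * r"]
    by (simp add: abs_mult)
  have "l * exp (- \<bar>p\<bar> / 2) \<le> (\<Sum>N\<in>fiber r M. ?g N * exp (p * frac (real N * r) / 2))" for M
  proof -
    have "l * exp (- \<bar>p\<bar> / 2) \<le> (\<Sum>N\<in>fiber r M. ?g N) * exp (- \<bar>p\<bar> / 2)"
      using lo by (rule mult_right_mono) simp
    also have "\<dots> \<le> (\<Sum>N\<in>fiber r M. ?g N * exp (p * frac (real N * r) / 2))"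
      unfolding sum_distrib_right using tb
      by (intro sum_mono mult_left_mono) (auto simp: abs_le_iff minus_le_iff)
    finally show ?thesis .
  qed
  then show "Z (- p) (gauss_map r) * (l * exp (- \<bar>p\<bar> / 2)) \<le> Z p r"
    unfolding Z_step[OF r] unfolding Z_def sum_distrib_right
    by (intro sum_mono mult_left_mono) auto
  have "(\<Sum>N\<in>fiber r M. ?g N * exp (p * frac (real N * r) / 2)) \<le> u * exp (\<bar>p\<bar> / 2)" for M
  proof -
    have "(\<Sum>N\<in>fiber r M. ?g N * exp (p * frac (real N * r) / 2)) \<le> (\<Sum>N\<in>fiber r M. ?g N) * exp (\<bar>p\<bar> / 2)"
      unfolding sum_distrib_right using tb
      by (intro sum_mono mult_left_mono) (auto simp: abs_le_iff)
    also have "\<dots> \<le> u * exp (\<bar>p\<bar> / 2)" using hi by (rule mult_right_mono) simp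
    finally show ?thesis .
  qed
  then show "Z p r \<le> Z (- p) (gauss_map r) * (u * exp (\<bar>p\<bar> / 2))"
    unfolding Z_step[OF r] unfolding Z_def sum_distrib_right
    by (intro sum_mono mult_left_mono) auto
qed

section \<open>One-step comparison of the logarithms of the partition functions\<close>

definition err :: "real \<Rightarrow> real" where
  "err P = max P (ln (1 / P))"

text \<open>Either \<open>P \<ge> 1/3\<close> or \<open>1 / P \<ge> 3 \<ge> exp 1\<close>, so
  \<open>err P\<close> is at least 1/3 and absorbs additive constants. With
  \<open>ln 10 \<le> 9\<close> this gives 28 = 9 * 3 + 1.\<close>

lemma err_ge:
  assumes "0 < P"
  shows "P \<le> err P" "1 \<le> 3 * err P" "ln (10 * max 1 (1 / P)) \<le> 28 * err P"
proof -
  show 1: "P \<le> err P" by (simp add: err_def)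
  show 2: "1 \<le> 3 * err P"
  proof (cases "1 / 3 \<le> P")
    case False
    then have "3 \<le> 1 / P" using assms by (simp add: field_simps)
    then have "exp 1 \<le> 1 / P" using exp_le by linarith
    then have "1 \<le> ln (1 / P)" using assms by (simp add: ln_ge_iff)
    then show ?thesis by (simp add: err_def)
  qed (use 1 in linarith)
  have "ln (max 1 (1 / P)) \<le> err P"
    using 2 by (auto simp: err_def max_def split: if_splits)
  moreover have "ln (10 * max 1 (1 / P)) = ln 10 + ln (max 1 (1 / P))"
    by (rule ln_mult_pos) auto
  moreover have "ln 10 \<le> (9::real)" using ln_le_minus_one[of 10] by simp
  ultimately show "ln (10 * max 1 (1 / P)) \<le> 28 * err P" using 2 by linarith
qed

text \<open>Weights of order 1 produce no main term. The lower bound loses \<open>P / 2\<close> from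
  the single retained point and \<open>P / 2\<close> from the factor
  \<open>exp (p t / 2)\<close>.\<close>

lemma ln_Z_step_pos:
  assumes r: "r \<in> {0<..<1} \<inter> \<rat>" and P: "0 < P"
  shows "\<bar>ln (Z P r) - ln (Z (- P) (gauss_map r))\<bar> \<le> 30 * err P"
proof -
  have r01: "0 < r" "r < 1" using r by auto
  let ?W = "Z (- P) (gauss_map r)"
  have W: "0 < ?W" using gauss_map_Rats[OF r] by (intro Z_pos) blast
  note b = Z_step_bounds[OF r, of "exp (- P / 2)" P "10 * max 1 (1 / P)",
      OF fiber_geometric_ge[OF r01 P] fiber_geometric_le[OF r01(1) P]]
  have Z: "0 < Z P r" using r by (intro Z_pos) auto
  let ?m = "10 * max 1 (1 / P)"
  have m: "0 < ?m" by simp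
  have "ln (?W * (exp (- P / 2) * exp (- \<bar>P\<bar> / 2))) \<le> ln (Z P r)"
    using b(1) W Z by (subst ln_le_cancel_iff) auto
  then have 1: "ln ?W - P \<le> ln (Z P r)" using W P by (simp add: ln_mult_pos)
  have "ln (Z P r) \<le> ln (?W * (?m * exp (\<bar>P\<bar> / 2)))"
    using b(2) W Z m by (subst ln_le_cancel_iff) (auto intro: mult_pos_pos)
  also have "\<dots> = ln ?W + ln ?m + P / 2"
    using W P m by (simp add: ln_mult_pos)
  finally have 2: "ln (Z P r) \<le> ln ?W + ln ?m + P / 2" .
  show ?thesis using 1 2 err_ge[OF P] by linarith
qed

text \<open>The main term is the logarithm of the Gaussian prefactor
  \<open>exp (P / (8 r)) / sqrt r\<close>, which both bounds on the weights share.\<close>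

lemma ln_Z_step_neg:
  assumes r: "r \<in> {0<..<1} \<inter> \<rat>" and P: "0 < P"
  shows "\<bar>ln (Z (- P) r) - ln (Z P (gauss_map r)) - (P / (8 * r) + ln (1 / r) / 2)\<bar> \<le> 30 * err P"
proof -
  have r01: "0 < r" "r < 1" using r by auto
  let ?W = "Z P (gauss_map r)"
  let ?E = "exp (P / (8 * r)) / sqrt r"
  have W: "0 < ?W" using gauss_map_Rats[OF r] by (intro Z_pos) blast
  have lo: "?E * (exp (- P / 8) / 2)
      \<le> (\<Sum>N\<in>fiber r M. exp (- (- P) * (frac (real N * r) * (1 - frac (real N * r)) / (2 * r))))"
    and hi: "(\<Sum>N\<in>fiber r M. exp (- (- P) * (frac (real N * r) * (1 - frac (real N * r)) / (2 * r))))
      \<le> ?E * (10 * max 1 (1 / P))" for M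
    using fiber_gaussian_ge[OF r01 P, of M] fiber_gaussian_le[OF r01 P, of M] by simp_all
  note b = Z_step_bounds[OF r, of _ "- P", OF lo hi, unfolded minus_minus abs_minus_cancel]
  have Z: "0 < Z (- P) r" using r by (intro Z_pos) auto
  let ?m = "10 * max 1 (1 / P)"
  have m: "0 < ?m" by simp
  have E: "0 < ?E" using r01 by simp
  have lnE: "ln ?E = P / (8 * r) + ln (1 / r) / 2"
    using r01 by (simp add: ln_divide_pos ln_sqrt)
  have "ln (?W * (?E * (exp (- P / 8) / 2) * exp (- \<bar>P\<bar> / 2))) \<le> ln (Z (- P) r)"
    using b(1) W Z r01 by (subst ln_le_cancel_iff) auto
  moreover have "ln (?W * (?E * (exp (- P / 8) / 2) * exp (- \<bar>P\<bar> / 2)))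
      = ln ?W + (ln ?E + (- P / 8 - ln 2) + - \<bar>P\<bar> / 2)"
    using W E by (simp only: ln_mult_pos ln_divide_pos exp_gt_zero mult_pos_pos divide_pos_pos ln_exp zero_less_numeral)
  moreover have "ln 2 \<le> (1::real)" using ln_le_minus_one[of 2] by simp
  ultimately have 1: "ln ?W + ln ?E - P - 1 \<le> ln (Z (- P) r)" using P by simp
  have "ln (Z (- P) r) \<le> ln (?W * (?E * ?m * exp (\<bar>P\<bar> / 2)))"
    using b(2) W Z m E by (subst ln_le_cancel_iff) (auto intro!: mult_pos_pos divide_pos_pos)
  also have "\<dots> = ln ?W + (ln ?E + ln ?m + P / 2)"
    using W P m E by (simp only: ln_mult_pos exp_gt_zero mult_pos_pos ln_exp abs_of_pos)
  finally have 2: "ln (Z (- P) r) \<le> ln ?W + (ln ?E + ln ?m + P / 2)" .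
  show ?thesis using 1 2 err_ge[OF P] unfolding lnE by linarith
qed

section \<open>Passage to the functionals \<open>J\<^sub>p\<close>\<close>

lemma J_ereal: "J (ereal p) r = Z p r powr (1 / p)"
  by (simp add: Z_def)

lemma gauss_map_twice: "(gauss_map ^^ 2) r = gauss_map (gauss_map r)"
  by (simp add: numeral_2_eq_2)

lemma gauss_map_twice_Rats:
  assumes "r \<in> {0<..<1} \<inter> \<rat>"
  shows "gauss_map (gauss_map r) \<in> {0<..<1} \<inter> \<rat> \<or> gauss_map (gauss_map r) = 0"
proof (cases "gauss_map r = 0")
  case True
  then show ?thesis by (simp add: gauss_map_def)
qed (use gauss_map_Rats assms in blast)

lemma h_ereal:
  assumes r: "r \<in> {0<..<1} \<inter> \<rat>"
  shows "h (ereal p) r = (ln (Z p r) - ln (Z p (gauss_map (gauss_map r)))) / p"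
  using Z_pos[of r p] Z_pos[OF gauss_map_twice_Rats[OF r], of p] r
  unfolding h_def J_ereal gauss_map_twice
  by (simp add: ln_divide_pos ln_powr diff_divide_distrib)

text \<open>\<open>err\<close> measures errors in \<open>ln Z\<close>; division by \<open>P\<close>
  turns it into the error term for \<open>h\<close>.\<close>

lemma err_eq: "0 < P \<Longrightarrow> err P = P * max 1 (1 / P * ln (1 / P))"
  by (simp add: err_def max_mult_distrib_left)

text \<open>The step from \<open>r\<close> at exponent \<open>P\<close> has no main term; the step
  from \<open>T r\<close> at exponent \<open>- P\<close> contributes the main term, evaluated at
  \<open>T r\<close>. If \<open>T r = 0\<close>, the second step is void, since \<open>Z\<close>
  equals 1 at 0. The two errors of 30 add up to 60.\<close>

lemma h_bound_pos:
  assumes r: "r \<in> {0<..<1} \<inter> \<rat>" and P: "0 < P"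
  shows "\<bar>h (ereal P) r - (if gauss_map r \<noteq> 0
      then 1 / (8 * gauss_map r) + 1 / P / 2 * ln (1 / gauss_map r) else 0)\<bar>
    \<le> 60 * max 1 (recip_log (ereal P))"
proof -
  let ?s = "gauss_map r"
  let ?D = "ln (Z P r) - ln (Z P (gauss_map ?s))"
  define m where "m = (if ?s \<noteq> 0 then P / (8 * ?s) + ln (1 / ?s) / 2 else 0)"
  have "\<bar>?D - m\<bar> \<le> 60 * err P"
  proof (cases "?s = 0")
    case True
    then show ?thesis
      using ln_Z_step_pos[OF r P] err_ge(1)[OF P] P by (simp add: m_def gauss_map_def[of 0])
  next
    case False
    then show ?thesis
      using ln_Z_step_pos[OF r P] ln_Z_step_neg[OF gauss_map_Rats[OF r False] P]
      by (simp add: m_def)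
  qed
  moreover have "h (ereal P) r - (if ?s \<noteq> 0
      then 1 / (8 * ?s) + 1 / P / 2 * ln (1 / ?s) else 0) = (?D - m) / P"
    unfolding h_ereal[OF r] m_def using P by (simp add: diff_divide_distrib add_divide_distrib)
  moreover have "recip_log (ereal P) = 1 / P * ln (1 / P)" using P by simp
  ultimately show ?thesis
    using P by (simp only: err_eq[OF P] abs_divide) (simp add: pos_divide_le_eq mult_ac)
qed

text \<open>The steps occur in the opposite order: the Gaussian one comes first, so the main term
  sits at \<open>r\<close> itself, which is never 0. Division by \<open>- P\<close> reverses its
  sign.\<close>

lemma h_bound_neg:
  assumes r: "r \<in> {0<..<1} \<inter> \<rat>" and P: "0 < P"
  shows "\<bar>h (ereal (- P)) r - (- 1 / (8 * r) + 1 / (- P) / 2 * ln (1 / r))\<bar>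
    \<le> 60 * max 1 (recip_log (ereal (- P)))"
proof -
  let ?s = "gauss_map r"
  let ?D = "ln (Z (- P) r) - ln (Z (- P) (gauss_map ?s))"
  define m where "m = P / (8 * r) + ln (1 / r) / 2"
  have "\<bar>?D - m\<bar> \<le> 60 * err P"
  proof (cases "?s = 0")
    case True
    then show ?thesis
      using ln_Z_step_neg[OF r P] err_ge(1)[OF P] P by (simp add: m_def gauss_map_def[of 0])
  next
    case False
    then show ?thesis
      using ln_Z_step_neg[OF r P] ln_Z_step_pos[OF gauss_map_Rats[OF r False] P]
      by (simp add: m_def)
  qed
  moreover have "h (ereal (- P)) r - (- 1 / (8 * r) + 1 / (- P) / 2 * ln (1 / r)) = - ((?D - m) / P)"
    unfolding h_ereal[OF r] m_def using P by (simp add: diff_divide_distrib add_divide_distrib)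
  moreover have "recip_log (ereal (- P)) = 1 / P * ln (1 / P)" using P by simp
  ultimately show ?thesis
    using P by (simp only: err_eq[OF P] abs_divide abs_minus_cancel) (simp add: pos_divide_le_eq mult_ac)
qed

section \<open>The exponents plus and minus infinity as limits\<close>

lemma ln_sum_exp_bounds:
  fixes S :: "'a \<Rightarrow> real"
  assumes "finite I" "i \<in> I" "\<And>j. j \<in> I \<Longrightarrow> S j \<le> S i"
  shows "S i \<le> ln (\<Sum>j\<in>I. exp (S j))" "ln (\<Sum>j\<in>I. exp (S j)) \<le> ln (real (card I)) + S i"
proof -
  have lo: "exp (S i) \<le> (\<Sum>j\<in>I. exp (S j))"
    using assms(1,2) by (intro member_le_sum) auto
  then show "S i \<le> ln (\<Sum>j\<in>I. exp (S j))"
    by (subst ln_ge_iff) (auto intro: less_le_trans[OF exp_gt_zero])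
  have c: "0 < real (card I)" using assms(1,2) card_gt_0_iff by auto
  have "(\<Sum>j\<in>I. exp (S j)) \<le> real (card I) * exp (S i)"
    using assms(3) by (intro sum_bounded_above) simp
  then have "ln (\<Sum>j\<in>I. exp (S j)) \<le> ln (real (card I) * exp (S i))"
    using c lo by (subst ln_le_cancel_iff) (auto intro: less_le_trans[OF exp_gt_zero])
  also have "\<dots> = ln (real (card I)) + S i" using c by (simp add: ln_mult_pos)
  finally show "ln (\<Sum>j\<in>I. exp (S j)) \<le> ln (real (card I)) + S i" .
qed

text \<open>A sum of \<open>q\<close> exponentials lies between its largest term and
  \<open>q\<close> times that term, so after taking logarithms and dividing by \<open>P\<close> the
  error is at most \<open>ln q / P\<close>. At exponent \<open>- P\<close> the largest term belongs
  to the minimum of the Birkhoff sums.\<close>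

lemma ln_J_tendsto:
  assumes r: "r \<in> {0<..<1} \<inter> \<rat> \<or> r = 0"
  shows "((\<lambda>P. ln (Z P r) / P) \<longlongrightarrow> ln (J \<infinity> r)) at_top" "0 < J \<infinity> r"
    and "((\<lambda>P. - ln (Z (- P) r) / P) \<longlongrightarrow> ln (J (-\<infinity>) r)) at_top" "0 < J (-\<infinity>) r"
proof -
  define q where "q = rat_denom r"
  have q: "0 < q" using rat_denom_pos[OF r] by (simp add: q_def)
  let ?V = "(\<lambda>N. exp (birkhoff_S N r)) ` {..<q}"
  have V: "finite ?V" "?V \<noteq> {}" using q by auto
  have lim: "((\<lambda>P. c + ln (real q) / P) \<longlongrightarrow> c) at_top" "((\<lambda>P. c - ln (real q) / P) \<longlongrightarrow> c) at_top" for c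
    by real_asymp+
  obtain i where i: "i < q" "J \<infinity> r = exp (birkhoff_S i r)"
    using Max_in[OF V] by (auto simp: q_def simp flip: PInfty_eq_infinity)
  have imax: "birkhoff_S j r \<le> birkhoff_S i r" if "j < q" for j
  proof -
    have "exp (birkhoff_S j r) \<le> J \<infinity> r"
      using that by (simp add: q_def flip: PInfty_eq_infinity)
    then show ?thesis by (simp add: i)
  qed
  show "0 < J \<infinity> r" by (simp add: i)
  show "((\<lambda>P. ln (Z P r) / P) \<longlongrightarrow> ln (J \<infinity> r)) at_top"
  proof (rule tendsto_sandwich)
    have *: "birkhoff_S i r \<le> ln (Z P r) / P \<and> ln (Z P r) / P \<le> birkhoff_S i r + ln (real q) / P"
      if "0 < P" for P
      using ln_sum_exp_bounds[of "{..<q}" i "\<lambda>N. P * birkhoff_S N r"] i imax that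
      by (simp add: Z_def q_def field_simps)
    show "\<forall>\<^sub>F P in at_top. birkhoff_S i r \<le> ln (Z P r) / P"
      "\<forall>\<^sub>F P in at_top. ln (Z P r) / P \<le> birkhoff_S i r + ln (real q) / P"
      using * by (auto intro: eventually_mono[OF eventually_gt_at_top[of 0]])
    show "((\<lambda>P. birkhoff_S i r) \<longlongrightarrow> ln (J \<infinity> r)) at_top"
      "((\<lambda>P. birkhoff_S i r + ln (real q) / P) \<longlongrightarrow> ln (J \<infinity> r)) at_top"
      using lim by (simp_all add: i)
  qed
  obtain k where k: "k < q" "J (-\<infinity>) r = exp (birkhoff_S k r)"
    using Min_in[OF V] by (auto simp: q_def simp flip: MInfty_eq_minfinity)
  have kmin: "birkhoff_S k r \<le> birkhoff_S j r" if "j < q" for j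
  proof -
    have "J (-\<infinity>) r \<le> exp (birkhoff_S j r)"
      using that by (simp add: q_def flip: MInfty_eq_minfinity)
    then show ?thesis by (simp add: k)
  qed
  show "0 < J (-\<infinity>) r" by (simp add: k)
  show "((\<lambda>P. - ln (Z (- P) r) / P) \<longlongrightarrow> ln (J (-\<infinity>) r)) at_top"
  proof (rule tendsto_sandwich)
    have *: "birkhoff_S k r - ln (real q) / P \<le> - ln (Z (- P) r) / P
        \<and> - ln (Z (- P) r) / P \<le> birkhoff_S k r" if "0 < P" for P
    proof -
      have "- P * birkhoff_S k r \<le> ln (Z (- P) r)"
        "ln (Z (- P) r) \<le> ln (real q) + - P * birkhoff_S k r"
        using ln_sum_exp_bounds[of "{..<q}" k "\<lambda>N. - P * birkhoff_S N r"] k kmin that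
        by (simp_all add: Z_def q_def)
      then have "(P * birkhoff_S k r - ln (real q)) / P \<le> - ln (Z (- P) r) / P"
        "- ln (Z (- P) r) / P \<le> P * birkhoff_S k r / P"
        using that by (intro divide_right_mono; simp)+
      then show ?thesis using that by (simp add: diff_divide_distrib)
    qed
    show "\<forall>\<^sub>F P in at_top. birkhoff_S k r - ln (real q) / P \<le> - ln (Z (- P) r) / P"
      "\<forall>\<^sub>F P in at_top. - ln (Z (- P) r) / P \<le> birkhoff_S k r"
      using * by (auto intro: eventually_mono[OF eventually_gt_at_top[of 0]])
    show "((\<lambda>P. birkhoff_S k r - ln (real q) / P) \<longlongrightarrow> ln (J (-\<infinity>) r)) at_top"
      "((\<lambda>P. birkhoff_S k r) \<longlongrightarrow> ln (J (-\<infinity>) r)) at_top"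
      using lim by (simp_all add: k)
  qed
qed

lemma h_tendsto:
  assumes r: "r \<in> {0<..<1} \<inter> \<rat>"
  shows "((\<lambda>P. h (ereal P) r) \<longlongrightarrow> h \<infinity> r) at_top"
    and "((\<lambda>P. h (ereal (- P)) r) \<longlongrightarrow> h (-\<infinity>) r) at_top"
proof -
  note r1 = disjI1[OF r] and r2 = gauss_map_twice_Rats[OF r]
  have "h \<infinity> r = ln (J \<infinity> r) - ln (J \<infinity> (gauss_map (gauss_map r)))"
    using ln_J_tendsto(2)[OF r1] ln_J_tendsto(2)[OF r2]
    by (simp add: h_def gauss_map_twice ln_divide_pos)
  then show "((\<lambda>P. h (ereal P) r) \<longlongrightarrow> h \<infinity> r) at_top"
    using tendsto_diff[OF ln_J_tendsto(1)[OF r1] ln_J_tendsto(1)[OF r2]]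
    by (simp add: h_ereal[OF r] diff_divide_distrib)
  have "h (-\<infinity>) r = ln (J (-\<infinity>) r) - ln (J (-\<infinity>) (gauss_map (gauss_map r)))"
    using ln_J_tendsto(4)[OF r1] ln_J_tendsto(4)[OF r2]
    by (simp add: h_def gauss_map_twice ln_divide_pos)
  then show "((\<lambda>P. h (ereal (- P)) r) \<longlongrightarrow> h (-\<infinity>) r) at_top"
    using tendsto_diff[OF ln_J_tendsto(3)[OF r1] ln_J_tendsto(3)[OF r2]]
    by (simp add: h_ereal[OF r] diff_divide_distrib)
qed

text \<open>For \<open>P \<ge> 1\<close> the logarithm of \<open>1 / P\<close> is nonpositive, so
  the error bound stays constant along the limit.\<close>

lemma max_recip_log_large:
  assumes "1 \<le> P"
  shows "max 1 (recip_log (ereal P)) = 1" "max 1 (recip_log (ereal (- P))) = 1"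
proof -
  have "1 / P * ln (1 / P) \<le> 0"
    using assms by (intro mult_nonneg_nonpos) (auto simp: ln_divide_pos)
  then show "max 1 (recip_log (ereal P)) = 1" "max 1 (recip_log (ereal (- P))) = 1"
    using assms by auto
qed

text \<open>The finite-exponent inequalities hold with the constant bound 60 for all
  \<open>P \<ge> 1\<close> and are closed under limits; the logarithmic terms carry a factor
  \<open>1 / P\<close> and vanish.\<close>

lemma h_bound_infinity:
  assumes r: "r \<in> {0<..<1} \<inter> \<rat>"
  shows "\<bar>h \<infinity> r - (if gauss_map r \<noteq> 0 then 1 / (8 * gauss_map r) else 0)\<bar> \<le> 60"
    and "\<bar>h (-\<infinity>) r - (- 1 / (8 * r))\<bar> \<le> 60"
proof -
  have lim0: "((\<lambda>P. 1 / P / 2 * c) \<longlongrightarrow> 0) at_top" "((\<lambda>P. 1 / (- P) / 2 * c) \<longlongrightarrow> 0) at_top"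
    for c :: real
    by real_asymp+
  show "\<bar>h \<infinity> r - (if gauss_map r \<noteq> 0 then 1 / (8 * gauss_map r) else 0)\<bar> \<le> 60"
  proof (rule tendsto_upperbound)
    show "((\<lambda>P. \<bar>h (ereal P) r - (if gauss_map r \<noteq> 0
        then 1 / (8 * gauss_map r) + 1 / P / 2 * ln (1 / gauss_map r) else 0)\<bar>)
      \<longlongrightarrow> \<bar>h \<infinity> r - (if gauss_map r \<noteq> 0 then 1 / (8 * gauss_map r) else 0)\<bar>) at_top"
      using h_tendsto(1)[OF r] tendsto_add[OF tendsto_const lim0(1)]
      by (intro tendsto_rabs tendsto_diff) auto
    show "\<forall>\<^sub>F P in at_top. \<bar>h (ereal P) r - (if gauss_map r \<noteq> 0
        then 1 / (8 * gauss_map r) + 1 / P / 2 * ln (1 / gauss_map r) else 0)\<bar> \<le> 60"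
      using eventually_ge_at_top[of 1]
    proof eventually_elim
      case (elim P)
      then show ?case using h_bound_pos[OF r, of P] by (simp only: max_recip_log_large) simp
    qed
  qed simp
  show "\<bar>h (-\<infinity>) r - (- 1 / (8 * r))\<bar> \<le> 60"
  proof (rule tendsto_upperbound)
    show "((\<lambda>P. \<bar>h (ereal (- P)) r - (- 1 / (8 * r) + 1 / (- P) / 2 * ln (1 / r))\<bar>)
      \<longlongrightarrow> \<bar>h (-\<infinity>) r - (- 1 / (8 * r))\<bar>) at_top"
      using tendsto_rabs[OF tendsto_diff[OF h_tendsto(2)[OF r] tendsto_add[OF tendsto_const lim0(2)]],
          of "- 1 / (8 * r)" "ln (1 / r)"] by (simp only: add_0_right)
    show "\<forall>\<^sub>F P in at_top. \<bar>h (ereal (- P)) r - (- 1 / (8 * r) + 1 / (- P) / 2 * ln (1 / r))\<bar> \<le> 60"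
      using eventually_ge_at_top[of 1]
    proof eventually_elim
      case (elim P)
      then show ?case using h_bound_neg[OF r, of P] by (simp only: max_recip_log_large) simp
    qed
  qed simp
qed

theorem theorem2:
  shows "\<exists>C::real. C > 0 \<and> (\<forall>p::ereal. p \<noteq> 0 \<longrightarrow> (\<forall>r::real. r \<in> {0<..<1} \<inter> \<rat> \<longrightarrow>
    (p > 0 \<longrightarrow>
      \<bar>h p r - (if gauss_map r \<noteq> 0
                 then 1 / (8 * gauss_map r) + recip p / 2 * ln (1 / gauss_map r)
                 else 0)\<bar>
        \<le> C * max 1 (recip_log p)) \<and>
    (p < 0 \<longrightarrow>
      \<bar>h p r - (- 1 / (8 * r) + recip p / 2 * ln (1 / r))\<bar>
        \<le> C * max 1 (recip_log p))))"
proof (intro exI[of _ 60] conjI allI impI)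
  \<comment> \<open>The constant 60 is twice the one-step error 30.\<close>
  fix p :: ereal and r :: real
  assume r: "r \<in> {0<..<1} \<inter> \<rat>"
  {
    assume "0 < p"
    then show "\<bar>h p r - (if gauss_map r \<noteq> 0
        then 1 / (8 * gauss_map r) + recip p / 2 * ln (1 / gauss_map r) else 0)\<bar>
      \<le> 60 * max 1 (recip_log p)"
    proof (cases p)
      case (real x)
      with \<open>0 < p\<close> have "0 < x" by simp
      from h_bound_pos[OF r this] show ?thesis unfolding real recip.simps .
    next
      case PInf
      then show ?thesis
        using h_bound_infinity(1)[OF r] by (simp split: if_splits flip: PInfty_eq_infinity)
    qed simp
  next
    assume "p < 0"
    then show "\<bar>h p r - (- 1 / (8 * r) + recip p / 2 * ln (1 / r))\<bar> \<le> 60 * max 1 (recip_log p)"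
    proof (cases p)
      case (real x)
      with \<open>p < 0\<close> have "0 < - x" by simp
      from h_bound_neg[OF r this] show ?thesis unfolding real recip.simps minus_minus .
    next
      case MInf
      then show ?thesis
        using h_bound_infinity(2)[OF r] by (simp flip: MInfty_eq_minfinity)
    qed simp
  }
qed simp

end
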